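(* Let $f:\mathbb{R}^d\to\mathbb{R}$ be differentiable and convex with unique minimizer $x_\star$, let $k:\mathbb{R}^d\to\mathbb{R}$ be differentiable and strictly convex with minimum $k(0)=0$, and let $\gamma\in(0,1)$. Assume: (i) there exist a differentiable, non-increasing, convex function $\alpha:[0,\infty)\to(0,1]$ and a constant $C_{\alpha,\gamma}\in(0,\gamma]$ such that $k(p)\ge\alpha(k(p))\max(f_c^*(p),f_c^*(-p))$ for all $p\in\mathbb{R}^d$ and $-C_{\alpha,\gamma}\alpha'(y)y<\alpha(y)$ for all $y\in[0,\infty)$; (ii) there exists $C_{f,k}\in(0,\infty)$ such that $|\langle\nabla f(x),\nabla k(p)\rangle|\le C_{f,k}\mathcal{H}(x,p)$ for all $x,p\in\mathbb{R}^d$. Suppose $0<\epsilon<\frac{1-\gamma}{2\max(C_{f,k},1)}$. Let $x_0\in\mathbb{R}^d$, $p_0=0$, and let $(x_i,p_i)_{i\ge0}$ satisfy $$\frac{x_{i+1}-x_i}{\epsilon}=\nabla k(p_{i+1}),\qquad \frac{p_{i+1}-p_i}{\epsilon}=-\gamma p_{i+1}-\nabla f(x_{i+1}).$$ Let $\mathcal{H}_0=\mathcal{H}(x_0,p_0)$, $\alpha_\star=\alpha(3\mathcal{H}_0)$, $\mathcal{W}_0=f(x_0)-f(x_\star)$, and for $i\ge0$ $$\mathcal{W}_{i+1}=\mathcal{W}_i\big[1+\epsilon C_{\alpha,\gamma}(1-\gamma-2C_{f,k}\epsilon)\,\alpha(2\mathcal{W}_i)/4\big]^{-1}.$$ Then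 for every $i\ge0$, $$f(x_i)-f(x_\star)\le 2\mathcal{W}_i\le 2\mathcal{W}_0\big[1+\epsilon C_{\alpha,\gamma}(1-\gamma-2C_{f,k}\epsilon)\,\alpha_\star/4\big]^{-i}.$$
   Context: $\langle\cdot,\cdot\rangle$ is the standard inner product on $\mathbb{R}^d$. $f_c(x)=f(x+x_\star)-f(x_\star)$, and $f_c^*(p)=\sup\{\langle x,p\rangle-f_c(x):x\in\mathbb{R}^d\}$ (possibly $+\infty$). $\mathcal{H}(x,p)=k(p)+f(x)-f(x_\star)$. The recursion is the paper's implicit method; it is well defined under the stated assumptions on $f$ and $k$. *)

theory Defs
  imports "HOL-Analysis.Analysis"
begin

definition strictly_convex_on :: "'a::real_vector set \<Rightarrow> ('a \<Rightarrow> real) \<Rightarrow> bool"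
  where "strictly_convex_on S f \<longleftrightarrow> convex S \<and>
    (\<forall>x\<in>S. \<forall>y\<in>S. \<forall>u>0. \<forall>v>0. x \<noteq> y \<longrightarrow> u + v = 1 \<longrightarrow>
      f (u *\<^sub>R x + v *\<^sub>R y) < u * f x + v * f y)"

definition centered :: "('a::real_vector \<Rightarrow> real) \<Rightarrow> 'a \<Rightarrow> 'a \<Rightarrow> real"
  where "centered f xs x = f (x + xs) - f xs"

(* The convex conjugate is ereal-valued because the supremum may be infinite. *)
definition conjugate :: "('a::real_inner \<Rightarrow> real) \<Rightarrow> 'a \<Rightarrow> ereal"
  where "conjugate h p = (SUP x. ereal (inner x p - h x))"

definition hamiltonian ::
    "('a::real_vector \<Rightarrow> real) \<Rightarrow> ('a \<Rightarrow> real) \<Rightarrow> 'a \<Rightarrow> 'a \<Rightarrow> 'a \<Rightarrow> real"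
  where "hamiltonian f k xs x p = k p + f x - f xs"

end

theory Submission
  imports Defs
begin

text \<open>
  Write \<open>H\<^sub>i\<close> for the Hamiltonian and \<open>T\<^sub>i = \<langle>x\<^sub>i - x\<^sub>\<star>, p\<^sub>i\<rangle>\<close>. The Lyapunov function is defined implicitly:
  \<open>V\<^sub>i \<ge> H\<^sub>i / 2\<close> is a root of \<open>v = H\<^sub>i + \<beta>(v) T\<^sub>i\<close> with \<open>\<beta>(v) = C \<alpha>(2 v) / 2\<close>. It exists because the
  conjugate bound gives \<open>\<alpha>(H\<^sub>i) \<bar>T\<^sub>i\<bar> \<le> H\<^sub>i\<close>. With the coefficient held at \<open>\<beta>(V\<^sub>i)\<close>, convexity of
  \<open>f\<close> and \<open>k\<close> gives a decrease of \<open>H + \<beta>(V\<^sub>i) T\<close> in one step that is proportional to \<open>H\<^sub>i\<^sub>+\<^sub>1\<close>;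
  convexity of \<open>\<alpha>\<close> and its growth condition control the change of \<open>\<beta>\<close>, so that
  \<open>V\<^sub>i\<^sub>+\<^sub>1\<close> is at most the image of \<open>V\<^sub>i\<close> under the map defining \<open>W\<close>. This map is monotone and
  \<open>V\<^sub>0 = W\<^sub>0\<close>, whence \<open>V\<^sub>i \<le> W\<^sub>i\<close> for all \<open>i\<close>.
\<close>

section \<open>Inequalities for convex functions and their conjugates\<close>

lemma convex_on_above_gradient:
  fixes f :: "'a::real_inner \<Rightarrow> real"
  assumes "convex_on UNIV f" "GDERIV f z :> g"
  shows "f z + inner g (y - z) \<le> f y"
proof -
  \<comment> \<open>Restricting \<open>f\<close> to the line through \<open>z\<close> and
    \<open>y\<close> reduces the claim to the tangent inequality in one variable.\<close>
  define h where "h t = f (z + t *\<^sub>R (y - z))" for t :: real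
  have "convex_on UNIV h"
  proof (rule convex_onI)
    fix t a b :: real
    assume t: "0 < t" "t < 1"
    have eq: "z + ((1 - t) *\<^sub>R a + t *\<^sub>R b) *\<^sub>R (y - z)
        = (1 - t) *\<^sub>R (z + a *\<^sub>R (y - z)) + t *\<^sub>R (z + b *\<^sub>R (y - z))"
      by (simp add: algebra_simps)
    show "h ((1 - t) *\<^sub>R a + t *\<^sub>R b) \<le> (1 - t) * h a + t * h b"
      unfolding h_def eq using convex_onD[OF assms(1)] t by simp
  qed simp
  moreover have "(h has_field_derivative inner g (y - z)) (at 0 within UNIV)"
  proof -
    have "(f has_derivative (\<lambda>v. inner v g)) (at (z + 0 *\<^sub>R (y - z)))"
      using assms(2) by (simp add: gderiv_def)
    moreover have "((\<lambda>t. z + t *\<^sub>R (y - z)) has_derivative (\<lambda>t. t *\<^sub>R (y - z))) (at 0)"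
      by (auto intro!: derivative_eq_intros)
    ultimately have "(h has_derivative (\<lambda>t. inner (t *\<^sub>R (y - z)) g)) (at 0)"
      unfolding h_def by (rule has_derivative_compose[rotated])
    then show ?thesis
      by (simp add: has_field_derivative_def inner_commute mult_commute_abs)
  qed
  ultimately have "h 1 - h 0 \<ge> inner g (y - z) * (1 - 0)"
    by (intro convex_on_imp_above_tangent[where A = UNIV]) auto
  then show ?thesis
    by (simp add: h_def)
qed

lemma strictly_convex_on_imp_convex_on:
  assumes "strictly_convex_on S f"
  shows "convex_on S f"
proof (rule convex_onI)
  fix t :: real and x y
  assume t: "0 < t" "t < 1" and S: "x \<in> S" "y \<in> S"
  show "f ((1 - t) *\<^sub>R x + t *\<^sub>R y) \<le> (1 - t) * f x + t * f y"
  proof (cases "x = y")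
    case True
    then show ?thesis by (simp add: algebra_simps flip: scaleR_left_distrib)
  next
    case False
    have "f ((1 - t) *\<^sub>R x + t *\<^sub>R y) < (1 - t) * f x + t * f y"
      using assms S t False unfolding strictly_convex_on_def by simp
    then show ?thesis by simp
  qed
qed (use assms in \<open>simp add: strictly_convex_on_def\<close>)

lemma conjugate_ge: "ereal (inner x p - h x) \<le> conjugate h p"
  unfolding conjugate_def by (rule SUP_upper) simp

text \<open>The Fenchel-Young inequality at \<open>z\<close>, applied to \<open>q\<close> and to
  \<open>- q\<close>: the two signs together produce the absolute value.\<close>

lemma conjugate_bound_abs_inner:
  assumes a: "0 \<le> a"
    and "ereal c \<ge> ereal a * max (conjugate h q) (conjugate h (- q))"
  shows "a * \<bar>inner z q\<bar> \<le> c + a * h z"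
proof -
  have *: "a * (inner z r - h z) \<le> c" if "r = q \<or> r = - q" for r
  proof -
    have "ereal a * ereal (inner z r - h z) \<le> ereal a * max (conjugate h q) (conjugate h (- q))"
      using that a conjugate_ge[of z r h] by (intro ereal_mult_left_mono) (auto simp: le_max_iff_disj)
    also have "\<dots> \<le> ereal c"
      by (fact assms(2))
    finally show ?thesis by simp
  qed
  from *[of q] *[of "- q"] show ?thesis
    by (auto simp: abs_if algebra_simps)
qed

section \<open>Dissipation in one implicit step\<close>

text \<open>\<open>E\<close> is the decrease of \<open>H + \<beta> T\<close> per unit of step size,
  with all quantities taken at the new iterate: \<open>K\<close> is the pairing of the gradient of
  \<open>k\<close> with the momentum, \<open>S\<close> that of the gradient of \<open>f\<close> with
  the displacement from the minimizer, \<open>G\<close> that of the two gradients. For negative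
  \<open>T\<close> the term \<open>\<beta> * \<gamma> * T\<close> works against the decrease, and
  half of the rate is given up to absorb it.\<close>

lemma dissipation_bound:
  fixes \<beta> \<gamma> \<epsilon> L K G S T F k :: real
  assumes \<beta>: "0 \<le> \<beta>" "\<beta> \<le> \<gamma> / 2" and \<gamma>: "0 < \<gamma>" "\<gamma> < 1"
    and \<epsilon>: "0 < \<epsilon>" "\<epsilon> \<le> (1 - \<gamma>) / 2" and L: "0 \<le> L"
    and k: "0 \<le> k" "k \<le> K" and F: "0 \<le> F" "F \<le> S"
    and G: "G \<le> L * (k + F)"
  defines "E \<equiv> (\<gamma> - \<beta> * (1 + \<epsilon> * \<gamma>)) * K + \<beta> * \<gamma> * T + \<beta> * S - \<epsilon> * \<beta> * G"
    and "r \<equiv> 1 - \<gamma> - 2 * L * \<epsilon>"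
  shows "0 \<le> T \<Longrightarrow> \<beta> * r * (k + F) \<le> E"
    and "\<beta> * \<bar>T\<bar> \<le> \<gamma> / 2 * k + \<beta> * F \<Longrightarrow> \<beta> * r / 2 * (k + F) \<le> E"
proof -
  have \<epsilon>\<gamma>: "\<epsilon> * \<gamma> \<le> (1 - \<gamma>) / 2 * \<gamma>"
    using \<epsilon> \<gamma> by (intro mult_right_mono) auto
  have \<epsilon>\<gamma>_le: "\<epsilon> * \<gamma> \<le> \<gamma> / 2"
    using mult_right_mono[of \<epsilon> "1 / 2" \<gamma>] \<epsilon> \<gamma> by auto
  have \<epsilon>\<gamma>_nonneg: "0 \<le> \<epsilon> * \<gamma>"
    using \<epsilon> \<gamma> by simp
  have coeff: "\<beta> * c \<le> \<gamma> / 2 * c" if "0 \<le> c" for c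
    using \<beta> that by (rule_tac mult_right_mono) auto
  have "\<beta> * (1 + \<epsilon> * \<gamma>) \<le> \<gamma> / 2 * (1 + \<epsilon> * \<gamma>)"
    using \<epsilon>\<gamma>_nonneg by (intro coeff) auto
  also have "\<dots> \<le> \<gamma> / 2 * 2"
    using \<gamma> \<epsilon>\<gamma>_le by (intro mult_left_mono) linarith+
  finally have "\<beta> * (1 + \<epsilon> * \<gamma>) \<le> \<gamma>"
    by simp
  then have "(\<gamma> - \<beta> * (1 + \<epsilon> * \<gamma>)) * k \<le> (\<gamma> - \<beta> * (1 + \<epsilon> * \<gamma>)) * K"
    using k by (intro mult_left_mono) auto
  moreover have "\<beta> * F \<le> \<beta> * S" "\<epsilon> * \<beta> * G \<le> \<epsilon> * \<beta> * (L * (k + F))"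
    using \<beta> F G \<epsilon> by (auto intro!: mult_left_mono)
  ultimately have E: "(\<gamma> - \<beta> * (1 + \<epsilon> * \<gamma>)) * k + \<beta> * \<gamma> * T + \<beta> * F - \<epsilon> * \<beta> * (L * (k + F)) \<le> E"
    unfolding E_def by linarith
  have L\<epsilon>: "0 \<le> \<beta> * (L * \<epsilon>)" "0 \<le> \<gamma> * \<beta>"
    using \<beta> L \<epsilon> \<gamma> by auto
  show "\<beta> * r * (k + F) \<le> E" if "0 \<le> T"
  proof -
    \<comment> \<open>After subtracting the target from the lower bound \<open>E\<close>, the
      coefficients of \<open>k\<close> and of \<open>F\<close> have to be nonnegative; this chain
      settles the one of \<open>k\<close>.\<close>
    have "\<beta> * (2 + \<epsilon> * \<gamma> - \<gamma>) \<le> \<gamma> / 2 * (2 + \<epsilon> * \<gamma> - \<gamma>)"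
      using \<gamma> \<epsilon>\<gamma>_nonneg by (intro coeff) linarith
    also have "\<dots> \<le> \<gamma> / 2 * 2"
      using \<gamma> \<epsilon>\<gamma>_le by (intro mult_left_mono) auto
    finally have "0 \<le> (\<gamma> - \<beta> * (2 + \<epsilon> * \<gamma> - \<gamma>) + \<beta> * (L * \<epsilon>)) * k"
      using k L\<epsilon> by (intro mult_nonneg_nonneg) auto
    moreover have "0 \<le> (\<gamma> * \<beta> + \<beta> * (L * \<epsilon>)) * F"
      using F L\<epsilon> by (intro mult_nonneg_nonneg) auto
    moreover have "0 \<le> \<beta> * \<gamma> * T"
      using that \<beta> \<gamma> by simp
    ultimately show ?thesis
      using E by (simp add: r_def algebra_simps)
  qed
  show "\<beta> * r / 2 * (k + F) \<le> E" if T: "\<beta> * \<bar>T\<bar> \<le> \<gamma> / 2 * k + \<beta> * F"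
  proof -
    have "\<gamma> * (\<beta> * \<bar>T\<bar>) \<le> \<gamma> * (\<gamma> / 2 * k + \<beta> * F)"
      using T \<gamma> by (intro mult_left_mono) auto
    moreover have "- (\<gamma> * (\<beta> * \<bar>T\<bar>)) \<le> \<beta> * \<gamma> * T"
      using \<beta> \<gamma> by (auto simp: abs_if algebra_simps)
    ultimately have T': "- (\<gamma> * (\<gamma> / 2 * k + \<beta> * F)) \<le> \<beta> * \<gamma> * T"
      by linarith
    \<comment> \<open>With half the rate the terms in \<open>L\<close> cancel exactly. The
      coefficient of \<open>k\<close> is nonnegative by the bound on \<open>\<epsilon>\<close> and
      \<open>(1 - \<gamma>)^2 \<ge> 0\<close>.\<close>
    have "\<beta> * (3 / 2 + \<epsilon> * \<gamma> - \<gamma> / 2) \<le> \<gamma> / 2 * (3 / 2 + \<epsilon> * \<gamma> - \<gamma> / 2)"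
      using \<gamma> \<epsilon>\<gamma>_nonneg by (intro coeff) linarith
    also have "\<dots> \<le> \<gamma> / 2 * (3 / 2 + (1 - \<gamma>) / 2 * \<gamma> - \<gamma> / 2)"
      using \<gamma> \<epsilon>\<gamma> by (intro mult_left_mono) auto
    also have "\<dots> \<le> \<gamma> / 2 * (2 - \<gamma>)"
    proof (intro mult_left_mono)
      have "0 \<le> (1 - \<gamma>) * (1 - \<gamma>)" by simp
      then show "3 / 2 + (1 - \<gamma>) / 2 * \<gamma> - \<gamma> / 2 \<le> 2 - \<gamma>"
        using \<gamma> by (simp add: field_simps)
    qed (use \<gamma> in auto)
    finally have "0 \<le> (\<gamma> - \<beta> * (3 / 2 + \<epsilon> * \<gamma> - \<gamma> / 2) - \<gamma> * \<gamma> / 2) * k"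
      using k by (intro mult_nonneg_nonneg) (auto simp: algebra_simps)
    moreover have "0 \<le> \<beta> * (1 / 2 - \<gamma> / 2) * F"
      using F \<beta> \<gamma> by (intro mult_nonneg_nonneg) auto
    ultimately show ?thesis
      using E T' by (simp add: r_def algebra_simps add_divide_distrib diff_divide_distrib)
  qed
qed

section \<open>Existence and decrease of the implicitly defined Lyapunov value\<close>

locale growth_rate =
  fixes \<alpha> \<alpha>' :: "real \<Rightarrow> real" and C :: real
  assumes range: "\<And>y. 0 \<le> y \<Longrightarrow> 0 < \<alpha> y \<and> \<alpha> y \<le> 1"
    and deriv: "\<And>y. 0 \<le> y \<Longrightarrow> (\<alpha> has_real_derivative \<alpha>' y) (at y within {0..})"
    and antimono: "antimono_on {0..} \<alpha>"
    and convex: "convex_on {0..} \<alpha>"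
    and growth: "\<And>y. 0 \<le> y \<Longrightarrow> - C * \<alpha>' y * y < \<alpha> y"
    and C: "0 < C" "C \<le> 1"
begin

lemma decreasing: "0 \<le> a \<Longrightarrow> a \<le> b \<Longrightarrow> \<alpha> b \<le> \<alpha> a"
  using antimono by (simp add: monotone_on_def)

text \<open>The tangent inequality at \<open>y\<close>, with the slope eliminated by the growth condition.\<close>

lemma secant_bound:
  assumes "0 < y" "y < z"
  shows "C * y * (\<alpha> y - \<alpha> z) < \<alpha> y * (z - y)"
proof -
  have "y \<in> interior {0..}"
    using assms by (simp add: interior_real_atLeast)
  then have "\<alpha>' y * (z - y) \<le> \<alpha> z - \<alpha> y"
    using assms by (intro convex_on_imp_above_tangent[OF convex _ _ _ deriv]) auto
  then have "C * y * (\<alpha> y - \<alpha> z) \<le> C * y * (- \<alpha>' y * (z - y))"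
    using assms C by (intro mult_left_mono) auto
  also have "\<dots> = (- C * \<alpha>' y * y) * (z - y)"
    by simp
  also have "\<dots> < \<alpha> y * (z - y)"
    using assms growth[of y] by (intro mult_strict_right_mono) auto
  finally show ?thesis .
qed

text \<open>For \<open>2 * v \<ge> H\<close> monotonicity of \<open>\<alpha>\<close> bounds the
  perturbation by \<open>H / 2\<close>, so the intermediate value theorem applies between
  \<open>H / 2\<close> and \<open>3 * H / 2\<close>.\<close>

lemma lyapunov_value_exists:
  assumes "0 \<le> H" "\<alpha> H * \<bar>T\<bar> \<le> H"
  shows "\<exists>v. H / 2 \<le> v \<and> v = H + C / 2 * \<alpha> (2 * v) * T"
proof -
  define g where "g v = v - C / 2 * \<alpha> (2 * v) * T" for v
  have cont: "continuous_on {0..} \<alpha>"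
    by (intro DERIV_continuous_on[of _ _ \<alpha>'] deriv) simp
  have bound: "C / 2 * \<alpha> y * \<bar>T\<bar> \<le> H / 2" if "H \<le> y" for y
  proof -
    have "\<alpha> y * \<bar>T\<bar> \<le> \<alpha> H * \<bar>T\<bar>"
      using decreasing[OF assms(1) that] by (rule mult_right_mono) simp
    then have "C * (\<alpha> y * \<bar>T\<bar>) \<le> 1 * H"
      using C assms range[of y] that by (intro mult_mono) auto
    then show ?thesis by simp
  qed
  have abs: "\<bar>C / 2 * \<alpha> y * T\<bar> = C / 2 * \<alpha> y * \<bar>T\<bar>" if "H \<le> y" for y
    using C range[of y] assms that by (simp add: abs_mult)
  have "g (H / 2) \<le> H" "H \<le> g (3 * H / 2)"
    using bound[of H] bound[of "3 * H"] abs[of H] abs[of "3 * H"] assms by (auto simp: g_def)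
  moreover have "continuous_on {H / 2..3 * H / 2} g"
    unfolding g_def using assms
    by (intro continuous_intros continuous_on_compose2[OF cont]) auto
  ultimately obtain v where "H / 2 \<le> v" "g v = H"
    using IVT'[of g "H / 2" H "3 * H / 2"] assms by auto
  then show ?thesis
    by (intro exI[of _ v]) (auto simp: g_def)
qed

text \<open>\<open>H\<close>, \<open>T\<close> and the root \<open>V'\<close> belong to the new
  iterate; \<open>V\<close> plays the role of the Lyapunov value before the step.\<close>

context
  fixes H T V V' :: real
  assumes H: "0 \<le> H" "H \<le> 2 * V" "H \<le> 2 * V'"
    and T: "\<alpha> H * \<bar>T\<bar> \<le> H"
    and V': "V' = H + C / 2 * \<alpha> (2 * V') * T"
begin

lemma scaled_bound: "H \<le> y \<Longrightarrow> \<alpha> y * \<bar>T\<bar> \<le> H"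
  using T H decreasing[of H y] by (meson abs_ge_zero mult_right_mono order_trans)

text \<open>In essence \<open>v - C / 2 * \<alpha> (2 * v) * T\<close> increases in \<open>v\<close>
  once \<open>2 * v \<ge> H\<close>. For \<open>T \<ge> 0\<close> this is the monotonicity of
  \<open>\<alpha>\<close>; for \<open>T < 0\<close> the secant bound keeps \<open>\<alpha>\<close>
  from falling too fast.\<close>

lemma lyapunov_value_le:
  assumes V: "H + C / 2 * \<alpha> (2 * V) * T \<le> V"
  shows "V' \<le> V"
proof (rule ccontr)
  assume "\<not> V' \<le> V"
  then have less: "V < V'" by simp
  have mono: "\<alpha> (2 * V') \<le> \<alpha> (2 * V)"
    using less H by (intro decreasing) auto
  have diff: "V' - V \<le> C / 2 * (\<alpha> (2 * V) - \<alpha> (2 * V')) * (- T)"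
    using V V' by (simp add: algebra_simps)
  have "T < 0"
  proof (rule ccontr)
    assume "\<not> T < 0"
    then have "0 \<le> C / 2 * (\<alpha> (2 * V) - \<alpha> (2 * V')) * T"
      using mono C by simp
    then show False
      using diff less by simp
  qed
  moreover have "0 < \<alpha> H"
    using range H by blast
  ultimately have "0 < \<alpha> H * \<bar>T\<bar>"
    by (simp add: mult_pos_neg)
  then have "0 < V"
    using T H by linarith
  \<comment> \<open>The factor \<open>4 * V\<close> creates the left side of the secant bound at
    \<open>2 * V\<close>; the chain ends in a quantity that is strictly smaller than itself.\<close>
  have "(V' - V) * (4 * V) \<le> C / 2 * (\<alpha> (2 * V) - \<alpha> (2 * V')) * (- T) * (4 * V)"
    using diff \<open>0 < V\<close> by (intro mult_right_mono) auto
  also have "\<dots> = C * (2 * V) * (\<alpha> (2 * V) - \<alpha> (2 * V')) * (- T)"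
    by simp
  also have "\<dots> < \<alpha> (2 * V) * (2 * V' - 2 * V) * (- T)"
    using secant_bound[of "2 * V" "2 * V'"] \<open>0 < V\<close> less \<open>T < 0\<close>
    by (intro mult_strict_right_mono) auto
  also have "\<dots> = 2 * (V' - V) * (\<alpha> (2 * V) * \<bar>T\<bar>)"
    using \<open>T < 0\<close> by (simp add: algebra_simps)
  also have "\<dots> \<le> 2 * (V' - V) * (2 * V)"
    using scaled_bound[of "2 * V"] H less by (intro mult_left_mono) auto
  finally show False by (simp add: algebra_simps)
qed

text \<open>Passing from \<open>\<alpha> (2 * V)\<close> to the larger
  \<open>\<alpha> (2 * V')\<close> only helps when \<open>T \<le> 0\<close>, and then also
  \<open>V' \<le> H\<close>, so the rate \<open>D / 2\<close> survives in full.\<close>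

lemma lyapunov_decrease_neg:
  assumes "T \<le> 0" "0 \<le> D" and V: "H + C / 2 * \<alpha> (2 * V) * T \<le> V - D / 2 * H"
  shows "V' * (1 + D / 2) \<le> V"
proof -
  have "V' \<le> V"
    using V \<open>0 \<le> D\<close> H(1) by (intro lyapunov_value_le) (smt (verit) mult_nonneg_nonneg divide_nonneg_nonneg)
  then have "\<alpha> (2 * V) \<le> \<alpha> (2 * V')"
    using H by (intro decreasing) auto
  then have "C / 2 * \<alpha> (2 * V') * T \<le> C / 2 * \<alpha> (2 * V) * T"
    using \<open>T \<le> 0\<close> C by (intro mult_right_mono_neg mult_left_mono) auto
  then have "V' \<le> V - D / 2 * H"
    using V V' by linarith
  moreover have "V' \<le> H"
  proof -
    have "C / 2 * \<alpha> (2 * V') * T \<le> 0"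
      using C \<open>T \<le> 0\<close> range[of "2 * V'"] H by (intro mult_nonneg_nonpos mult_nonneg_nonneg) auto
    then show ?thesis using V' by linarith
  qed
  then have "D / 2 * V' \<le> D / 2 * H"
    using \<open>0 \<le> D\<close> by (intro mult_left_mono) auto
  ultimately show ?thesis
    by (simp add: algebra_simps)
qed

text \<open>For \<open>T \<ge> 0\<close> the change of coefficient costs energy. The secant bound
  charges this cost to \<open>V - V'\<close>, which halves the rate; hence the assumption with
  \<open>D\<close> in place of \<open>D / 2\<close>.\<close>

lemma lyapunov_decrease_nonneg:
  assumes "0 \<le> T" "0 \<le> D" and V: "H + C / 2 * \<alpha> (2 * V) * T \<le> V - D * H"
  shows "V' * (1 + D / 2) \<le> V"
proof -
  have le: "V' \<le> V"
    using V \<open>0 \<le> D\<close> H(1) by (intro lyapunov_value_le) (smt (verit) mult_nonneg_nonneg)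
  define a where "a = \<alpha> (2 * V') * T"
  have a: "0 \<le> a" "a \<le> H"
    using scaled_bound[of "2 * V'"] range[of "2 * V'"] H \<open>0 \<le> T\<close> by (auto simp: a_def)
  have V'_eq: "V' = H + C / 2 * a"
    using V' by (simp add: a_def)
  have "C * a \<le> 1 * H"
    using C a by (intro mult_mono) auto
  then have le2H: "V' + a / 2 \<le> 2 * H"
    using V'_eq a by simp
  show ?thesis
  proof (cases "H = 0")
    case True
    then show ?thesis
      using V'_eq a le by simp
  next
    case False
    then have "0 < H" "0 < V'"
      using H by auto
    have sec: "C * (2 * V') * (\<alpha> (2 * V') - \<alpha> (2 * V)) \<le> \<alpha> (2 * V') * (2 * V - 2 * V')"
      using secant_bound[of "2 * V'" "2 * V"] \<open>0 < V'\<close> le by (cases "V' = V") auto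
    have "D * H \<le> V - V' + C / 2 * (\<alpha> (2 * V') - \<alpha> (2 * V)) * T"
      using V V' by (simp add: algebra_simps)
    \<comment> \<open>Multiplication by \<open>V'\<close> brings the change of
      \<open>\<alpha>\<close> into the form of \<open>sec\<close>.\<close>
    then have "(D * H) * V' \<le> (V - V' + C / 2 * (\<alpha> (2 * V') - \<alpha> (2 * V)) * T) * V'"
      using \<open>0 < V'\<close> by (intro mult_right_mono) auto
    also have "\<dots> = (V - V') * V' + C * (2 * V') * (\<alpha> (2 * V') - \<alpha> (2 * V)) * T / 4"
      by (simp add: field_simps)
    also have "\<dots> \<le> (V - V') * V' + \<alpha> (2 * V') * (2 * V - 2 * V') * T / 4"
      using sec \<open>0 \<le> T\<close> by (intro add_left_mono divide_right_mono mult_right_mono) auto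
    also have "\<dots> = (V - V') * (V' + a / 2)"
      by (simp add: a_def field_simps)
    also have "\<dots> \<le> (V - V') * (2 * H)"
      using le le2H by (intro mult_left_mono) auto
    finally have "(D * V') * H \<le> (2 * (V - V')) * H"
      by (simp add: algebra_simps)
    then have "D * V' \<le> 2 * (V - V')"
      using \<open>0 < H\<close> by simp
    then show ?thesis
      by (simp add: algebra_simps)
  qed
qed

end

text \<open>Carries \<open>V \<le> W\<close> through one step of the recursion: a larger argument
  raises the numerator and, by monotonicity of \<open>\<alpha>\<close>, lowers the
  denominator.\<close>

lemma recursion_map_mono:
  assumes "0 \<le> v" "v \<le> w" "0 \<le> c"
  shows "v / (1 + c * \<alpha> (2 * v)) \<le> w / (1 + c * \<alpha> (2 * w))"
proof -
  have "c * \<alpha> (2 * w) \<le> c * \<alpha> (2 * v)"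
    using assms by (intro mult_left_mono decreasing) auto
  moreover have "0 \<le> c * \<alpha> (2 * w)"
    using assms range[of "2 * w"] by simp
  ultimately show ?thesis
    using assms by (intro frac_le) auto
qed

end

theorem proposition3p2:
  fixes f k :: "real ^ 'n \<Rightarrow> real"
    and grad_f grad_k :: "real ^ 'n \<Rightarrow> real ^ 'n"
    and xs :: "real ^ 'n"
    and \<alpha> \<alpha>' :: "real \<Rightarrow> real"
    and \<gamma> C\<alpha> Cfk \<epsilon> :: real
    and x p :: "nat \<Rightarrow> real ^ 'n"
    and W :: "nat \<Rightarrow> real"
  assumes f_diff: "\<And>z. GDERIV f z :> grad_f z"
    and f_convex: "convex_on UNIV f"
    and f_min: "\<And>y. (\<forall>z. f y \<le> f z) \<longleftrightarrow> y = xs"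
    and k_diff: "\<And>q. GDERIV k q :> grad_k q"
    and k_convex: "strictly_convex_on UNIV k"
    and k_min: "\<And>q. k 0 \<le> k q" and k_zero: "k 0 = 0"
    and \<gamma>: "0 < \<gamma>" "\<gamma> < 1"
    and \<alpha>_range: "\<And>y. 0 \<le> y \<Longrightarrow> 0 < \<alpha> y \<and> \<alpha> y \<le> 1"
    and \<alpha>_diff: "\<And>y. 0 \<le> y \<Longrightarrow> (\<alpha> has_real_derivative \<alpha>' y) (at y within {0..})"
    and \<alpha>_antimono: "antimono_on {0..} \<alpha>"
    and \<alpha>_convex: "convex_on {0..} \<alpha>"
    and C\<alpha>: "0 < C\<alpha>" "C\<alpha> \<le> \<gamma>"
    and k_lower: "\<And>q. ereal (k q) \<ge>
        ereal (\<alpha> (k q)) * max (conjugate (centered f xs) q) (conjugate (centered f xs) (- q))"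
    and \<alpha>_growth: "\<And>y. 0 \<le> y \<Longrightarrow> - C\<alpha> * \<alpha>' y * y < \<alpha> y"
    and Cfk: "0 < Cfk"
    and grad_bound: "\<And>z q. \<bar>inner (grad_f z) (grad_k q)\<bar> \<le> Cfk * hamiltonian f k xs z q"
    and \<epsilon>: "0 < \<epsilon>" "\<epsilon> < (1 - \<gamma>) / (2 * max Cfk 1)"
    and p0: "p 0 = 0"
    and x_step: "\<And>i. (x (Suc i) - x i) /\<^sub>R \<epsilon> = grad_k (p (Suc i))"
    and p_step: "\<And>i. (p (Suc i) - p i) /\<^sub>R \<epsilon> = - \<gamma> *\<^sub>R p (Suc i) - grad_f (x (Suc i))"
    and W0: "W 0 = f (x 0) - f xs"
    and W_step: "\<And>i. W (Suc i) =
        W i * inverse (1 + \<epsilon> * C\<alpha> * (1 - \<gamma> - 2 * Cfk * \<epsilon>) * \<alpha> (2 * W i) / 4)"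
  shows "\<forall>i. f (x i) - f xs \<le> 2 * W i \<and>
      2 * W i \<le> 2 * W 0 *
        (1 + \<epsilon> * C\<alpha> * (1 - \<gamma> - 2 * Cfk * \<epsilon>) *
             \<alpha> (3 * hamiltonian f k xs (x 0) (p 0)) / 4) powi (- int i)"
proof -

  \<comment> \<open>Bounds along the iterates and choice of the Lyapunov sequence\<close>
  define r where "r = 1 - \<gamma> - 2 * Cfk * \<epsilon>"
  define F where "F i = f (x i) - f xs" for i
  define H where "H i = k (p i) + F i" for i
  define T where "T i = inner (x i - xs) (p i)" for i
  interpret growth_rate \<alpha> \<alpha>' C\<alpha>
    using \<alpha>_range \<alpha>_diff \<alpha>_antimono \<alpha>_convex \<alpha>_growth C\<alpha> \<gamma>
    by unfold_locales auto
  note k_conv = strictly_convex_on_imp_convex_on[OF k_convex]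
  \<comment> \<open>The maximum serves twice: its entry \<open>Cfk\<close> makes \<open>r\<close>
    positive, its entry \<open>1\<close> gives
    \<open>\<epsilon> \<le> (1 - \<gamma>) / 2\<close>.\<close>
  have "\<epsilon> * (2 * max Cfk 1) < 1 - \<gamma>"
    using \<epsilon>(2) by (simp add: pos_less_divide_eq)
  moreover have "\<epsilon> * (2 * Cfk) \<le> \<epsilon> * (2 * max Cfk 1)" "\<epsilon> * (2 * 1) \<le> \<epsilon> * (2 * max Cfk 1)"
    using \<epsilon>(1) by (intro mult_left_mono; simp)+
  ultimately have r: "0 < r" and \<epsilon>_small: "\<epsilon> \<le> (1 - \<gamma>) / 2"
    by (auto simp: r_def algebra_simps)
  have xs_min: "f xs \<le> f z" for z
    using f_min by blast
  have k_nonneg: "0 \<le> k q" for q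
    using k_min k_zero by metis
  have F_nonneg: "0 \<le> F i" for i
    using xs_min by (simp add: F_def)
  have H_nonneg: "0 \<le> H i" for i
    using F_nonneg k_nonneg by (simp add: H_def)
  \<comment> \<open>Any coefficient up to \<open>\<alpha> (k (p i))\<close> is allowed, since the
    bound is needed below at \<open>\<alpha> (H i)\<close> and at the previous Lyapunov
    value.\<close>
  have T_bound: "a * \<bar>T i\<bar> \<le> k (p i) + a * F i" if "0 \<le> a" "a \<le> \<alpha> (k (p i))" for a i
  proof -
    have "\<alpha> (k (p i)) * \<bar>T i\<bar> \<le> k (p i) + \<alpha> (k (p i)) * centered f xs (x i - xs)"
      unfolding T_def using \<alpha>_range[OF k_nonneg]
      by (intro conjugate_bound_abs_inner k_lower) (simp add: less_imp_le)
    then have *: "\<alpha> (k (p i)) * (\<bar>T i\<bar> - F i) \<le> k (p i)"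
      by (simp add: centered_def F_def right_diff_distrib)
    have "a * (\<bar>T i\<bar> - F i) \<le> k (p i)"
    proof (cases "0 \<le> \<bar>T i\<bar> - F i")
      case True
      then show ?thesis
        using mult_right_mono[OF that(2) True] * by linarith
    next
      case False
      then show ?thesis
        using mult_nonneg_nonpos[OF that(1), of "\<bar>T i\<bar> - F i"] k_nonneg[of "p i"] by linarith
    qed
    then show ?thesis
      by (simp add: right_diff_distrib)
  qed
  have T_H: "\<alpha> (H i) * \<bar>T i\<bar> \<le> H i" for i
  proof -
    have "\<alpha> (H i) \<le> \<alpha> (k (p i))"
      using k_nonneg F_nonneg by (intro decreasing) (auto simp: H_def)
    then have "\<alpha> (H i) * \<bar>T i\<bar> \<le> k (p i) + \<alpha> (H i) * F i"
      using \<alpha>_range[OF H_nonneg] by (intro T_bound) (auto simp: less_imp_le)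
    also have "\<dots> \<le> k (p i) + 1 * F i"
      using \<alpha>_range[OF H_nonneg] F_nonneg by (intro add_left_mono mult_right_mono) auto
    finally show ?thesis
      by (simp add: H_def)
  qed
  obtain V where V_ge: "H i / 2 \<le> V i" and V_eq: "V i = H i + C\<alpha> / 2 * \<alpha> (2 * V i) * T i" for i
    using lyapunov_value_exists[OF H_nonneg T_H] by metis
  have V_nonneg: "0 \<le> V i" for i
    using V_ge[of i] H_nonneg[of i] by linarith

  \<comment> \<open>Decrease of the Lyapunov sequence in one step\<close>
  define rate where "rate w = \<epsilon> * C\<alpha> * r * \<alpha> (2 * w) / 4" for w
  have step: "V (Suc i) * (1 + rate (V i)) \<le> V i" for i
  proof -
    \<comment> \<open>The coefficient is frozen at the old value \<open>V i\<close>; the decrease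
      lemmas later replace it by the one belonging to \<open>V (Suc i)\<close>.\<close>
    define \<beta> where "\<beta> = C\<alpha> / 2 * \<alpha> (2 * V i)"
    define g where "g = grad_f (x (Suc i))"
    define K where "K = inner (grad_k (p (Suc i))) (p (Suc i))"
    define G where "G = inner g (grad_k (p (Suc i)))"
    define S where "S = inner g (x (Suc i) - xs)"
    define E where "E = (\<gamma> - \<beta> * (1 + \<epsilon> * \<gamma>)) * K + \<beta> * \<gamma> * T (Suc i) + \<beta> * S - \<epsilon> * \<beta> * G"
    have dx: "x (Suc i) - x i = \<epsilon> *\<^sub>R grad_k (p (Suc i))"
      unfolding x_step[symmetric] using \<epsilon>(1) by simp
    have dp: "p (Suc i) - p i = \<epsilon> *\<^sub>R (- \<gamma> *\<^sub>R p (Suc i) - g)"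
      unfolding g_def p_step[symmetric] using \<epsilon>(1) by simp
    have \<alpha>V: "0 < \<alpha> (2 * V i)" "\<alpha> (2 * V i) \<le> 1"
      using \<alpha>_range V_nonneg[of i] by auto
    have "C\<alpha> * \<alpha> (2 * V i) \<le> \<gamma> * 1"
      using C\<alpha> \<gamma> \<alpha>V by (intro mult_mono) auto
    then have \<beta>: "0 \<le> \<beta>" "\<beta> \<le> \<gamma> / 2"
      using C\<alpha> \<alpha>V by (auto simp: \<beta>_def)
    have Vi: "V i = H i + \<beta> * T i"
      using V_eq by (simp add: \<beta>_def)
    \<comment> \<open>The tangents of \<open>f\<close> and \<open>k\<close> are taken at the new
      iterate, where the implicit step evaluates both gradients. The terms
      \<open>\<epsilon> * G\<close> then cancel in the sum \<open>H\<close>.\<close>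
    have "F (Suc i) \<le> F i + inner g (x (Suc i) - x i)"
      using convex_on_above_gradient[OF f_convex f_diff, of "x (Suc i)" "x i"]
      by (simp add: F_def g_def inner_diff_right)
    then have dF: "F (Suc i) \<le> F i + \<epsilon> * G"
      by (simp add: dx G_def)
    have "k (p (Suc i)) \<le> k (p i) + inner (grad_k (p (Suc i))) (p (Suc i) - p i)"
      using convex_on_above_gradient[OF k_conv k_diff, of "p (Suc i)" "p i"]
      by (simp add: inner_diff_right)
    then have dk: "k (p (Suc i)) \<le> k (p i) - \<epsilon> * \<gamma> * K - \<epsilon> * G"
      by (simp add: dp K_def G_def inner_diff_right inner_commute algebra_simps)
    \<comment> \<open>Discrete product rule anchored at the new iterate; its quadratic remainder
      yields the terms of second order in \<open>\<epsilon>\<close>.\<close>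
    have "T (Suc i) - T i = inner (x (Suc i) - x i) (p (Suc i))
        + inner (x (Suc i) - xs) (p (Suc i) - p i) - inner (x (Suc i) - x i) (p (Suc i) - p i)"
      by (simp add: T_def algebra_simps)
    also have "\<dots> = \<epsilon> * K - \<epsilon> * \<gamma> * T (Suc i) - \<epsilon> * S + \<epsilon> * \<epsilon> * (\<gamma> * K + G)"
      unfolding dx dp
      by (simp add: K_def G_def S_def T_def inner_commute algebra_simps)
    finally have dT: "T (Suc i) = T i
        + (\<epsilon> * K - \<epsilon> * \<gamma> * T (Suc i) - \<epsilon> * S + \<epsilon> * \<epsilon> * (\<gamma> * K + G))"
      by simp
    have S: "F (Suc i) \<le> S"
      using convex_on_above_gradient[OF f_convex f_diff, of "x (Suc i)" xs]
      by (simp add: F_def S_def g_def inner_diff_right)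
    have K: "k (p (Suc i)) \<le> K"
      using convex_on_above_gradient[OF k_conv k_diff, of "p (Suc i)" 0]
      by (simp add: K_def k_zero)
    have G: "G \<le> Cfk * (k (p (Suc i)) + F (Suc i))"
      using grad_bound[of "x (Suc i)" "p (Suc i)"]
      by (simp add: G_def g_def hamiltonian_def F_def add_diff_eq)
    have "H (Suc i) + \<beta> * T (Suc i) \<le> H i - \<epsilon> * \<gamma> * K + \<beta> * T (Suc i)"
      using dF dk by (simp add: H_def)
    also have "\<dots> = V i - \<epsilon> * E"
      unfolding Vi by (subst dT) (simp add: E_def algebra_simps)
    finally have energy: "H (Suc i) + \<beta> * T (Suc i) \<le> V i - \<epsilon> * E" .
    have "0 \<le> \<epsilon> * \<gamma> * K"
      using \<epsilon> \<gamma> K k_nonneg[of "p (Suc i)"] by simp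
    then have H_le: "H (Suc i) \<le> 2 * V i"
      using dF dk V_ge[of i] by (simp add: H_def)
    note dissipation = dissipation_bound[OF \<beta> \<gamma> \<epsilon>(1) \<epsilon>_small less_imp_le[OF Cfk] k_nonneg K
        F_nonneg S G, of "T (Suc i)", folded E_def H_def r_def]
    note decrease = H_nonneg[of "Suc i"] H_le _ T_H[of "Suc i"] V_eq[of "Suc i"]
    define D where "D = \<epsilon> * \<beta> * r"
    have D: "0 \<le> D"
      using \<epsilon> \<beta> r by (simp add: D_def)
    have H_le': "H (Suc i) \<le> 2 * V (Suc i)"
      using V_ge[of "Suc i"] by simp
    have "V (Suc i) * (1 + D / 2) \<le> V i"
    \<comment> \<open>For \<open>T \<ge> 0\<close> the dissipation has the full rate and the change
      of coefficient halves it; for \<open>T < 0\<close> the dissipation is already halved and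
      nothing more is lost. Both cases end with \<open>D / 2\<close>.\<close>
    proof (cases "0 \<le> T (Suc i)")
      case True
      have "\<epsilon> * (\<beta> * r * H (Suc i)) \<le> \<epsilon> * E"
        using dissipation(1)[OF True] \<epsilon>(1) by (intro mult_left_mono) auto
      then have "H (Suc i) + \<beta> * T (Suc i) \<le> V i - D * H (Suc i)"
        using energy by (simp add: D_def mult.assoc)
      then show ?thesis
        using lyapunov_decrease_nonneg[OF decrease True D] H_le' by (simp add: \<beta>_def)
    next
      case False
      \<comment> \<open>The conjugate bound may be used with \<open>\<alpha> (2 * V i)\<close>
        because \<open>k (p (Suc i)) \<le> H (Suc i) \<le> 2 * V i\<close>.\<close>
      have "\<alpha> (2 * V i) \<le> \<alpha> (k (p (Suc i)))"
        using H_le F_nonneg[of "Suc i"] k_nonneg by (intro decreasing) (auto simp: H_def)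
      then have "\<alpha> (2 * V i) * \<bar>T (Suc i)\<bar> \<le> k (p (Suc i)) + \<alpha> (2 * V i) * F (Suc i)"
        using \<alpha>V by (intro T_bound) auto
      then have "C\<alpha> / 2 * (\<alpha> (2 * V i) * \<bar>T (Suc i)\<bar>)
          \<le> C\<alpha> / 2 * (k (p (Suc i)) + \<alpha> (2 * V i) * F (Suc i))"
        using C\<alpha> by (intro mult_left_mono) auto
      moreover have "C\<alpha> / 2 * k (p (Suc i)) \<le> \<gamma> / 2 * k (p (Suc i))"
        using C\<alpha> k_nonneg by (intro mult_right_mono) auto
      ultimately have "\<beta> * \<bar>T (Suc i)\<bar> \<le> \<gamma> / 2 * k (p (Suc i)) + \<beta> * F (Suc i)"
        by (simp add: \<beta>_def algebra_simps)
      from dissipation(2)[OF this] have "\<epsilon> * (\<beta> * r / 2 * H (Suc i)) \<le> \<epsilon> * E"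
        using \<epsilon>(1) by (intro mult_left_mono) auto
      then have "H (Suc i) + \<beta> * T (Suc i) \<le> V i - D / 2 * H (Suc i)"
        using energy by (simp add: D_def mult.assoc)
      then show ?thesis
        using lyapunov_decrease_neg[OF decrease _ D] H_le' False by (simp add: \<beta>_def)
    qed
    \<comment> \<open>The denominator 4 of the rate combines the half in \<open>\<beta>\<close> with
      the half in \<open>D / 2\<close>.\<close>
    moreover have "D / 2 = rate (V i)"
      by (simp add: D_def \<beta>_def rate_def)
    ultimately show ?thesis
      by simp
  qed

  \<comment> \<open>Comparison with the recursion and the geometric bound\<close>
  have rate_nonneg: "0 \<le> rate w" if "0 \<le> w" for w
    using \<alpha>_range[of "2 * w"] that \<epsilon> C\<alpha> r by (simp add: rate_def)
  have W_Suc: "W (Suc i) = W i / (1 + rate (W i))" for i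
    unfolding rate_def r_def by (subst W_step) (rule divide_inverse[symmetric])
  \<comment> \<open>Zero initial momentum makes both \<open>T 0\<close> and the initial kinetic
    energy vanish.\<close>
  have V0: "V 0 = W 0"
    using V_eq[of 0] by (simp add: T_def H_def F_def p0 k_zero W0)
  have V_le_W: "V i \<le> W i" for i
  proof (induction i)
    case 0
    then show ?case by (simp add: V0)
  next
    case (Suc i)
    have "V (Suc i) \<le> V i / (1 + rate (V i))"
      using step[of i] rate_nonneg[OF V_nonneg, of i] by (simp add: pos_le_divide_eq)
    also have "\<dots> \<le> W i / (1 + rate (W i))"
      using recursion_map_mono[OF V_nonneg Suc, of "\<epsilon> * C\<alpha> * r / 4"] \<epsilon> C\<alpha> r
      by (simp add: rate_def)
    finally show ?case by (simp add: W_Suc)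
  qed
  have W_nonneg: "0 \<le> W i" for i
    using V_nonneg V_le_W order_trans by blast
  define q where "q = 1 + \<epsilon> * C\<alpha> * r * \<alpha> (3 * W 0) / 4"
  have q: "1 \<le> q"
    using \<alpha>_range[of "3 * W 0"] W_nonneg[of 0] \<epsilon> C\<alpha> r by (simp add: q_def)
  \<comment> \<open>The two bounds are proved together: \<open>W i \<le> W 0\<close> gives
    \<open>2 * W i \<le> 3 * W 0\<close>, so every step contracts at least by the factor
    \<open>q\<close>.\<close>
  have W_bound: "W i \<le> W 0 \<and> W i \<le> W 0 / q ^ i" for i
  proof (induction i)
    case 0
    then show ?case by simp
  next
    case (Suc i)
    have "\<alpha> (3 * W 0) \<le> \<alpha> (2 * W i)"
      using Suc W_nonneg[of i] W_nonneg[of 0] by (intro decreasing) auto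
    then have "q \<le> 1 + rate (W i)"
      unfolding q_def rate_def using \<epsilon> C\<alpha> r
      by (intro add_left_mono divide_right_mono mult_left_mono) auto
    then have le: "W (Suc i) \<le> W i / q"
      unfolding W_Suc using q W_nonneg[of i] by (intro frac_le) auto
    also have "\<dots> \<le> W 0 / q ^ i / q"
      using Suc q by (intro divide_right_mono) auto
    finally have "W (Suc i) \<le> W 0 / q ^ Suc i"
      by (simp add: mult.commute)
    moreover have "W i / q \<le> W i / 1"
      using q W_nonneg[of i] by (intro frac_le) auto
    ultimately show ?case
      using le Suc by auto
  qed
  \<comment> \<open>Since \<open>k\<close> is nonnegative, the gap is at most \<open>H i\<close>,
    which is at most \<open>2 * V i\<close>.\<close>
  have "f (x i) - f xs \<le> 2 * W i" for i
    using V_ge[of i] V_le_W[of i] k_nonneg[of "p i"] by (simp add: H_def F_def)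
  moreover have "2 * W i \<le> 2 * W 0 * q powi (- int i)" for i
    using W_bound[of i] by (simp add: power_int_minus divide_simps)
  moreover have "hamiltonian f k xs (x 0) (p 0) = W 0"
    by (simp add: hamiltonian_def p0 k_zero W0)
  ultimately show ?thesis
    by (simp add: q_def r_def)
qed

end
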